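(* The set of rational values $\rho\in(-1,1)$ for which a scalene rational $\theta$-triangle (where $\cos\theta=\rho$) has two distinct genuine rational isosceles partners with the same perimeter and area is dense in $(-1,1)$. That is, the set of $\rho\in\mathbb{Q}\cap(-1,1)$ for which there exist a scalene rational triangle $T$ with an angle $\theta$ and two non-congruent isosceles rational triangles $I_1,I_2$ such that $(T,I_1)$ and $(T,I_2)$ are both genuine pairs is dense in $(-1,1)$.
   Context: A rational triangle is a triangle with rational side lengths (its area need not be rational). For $\rho\in\mathbb{Q}\cap(-1,1)$ let $\theta\in(0,\pi)$ be the angle with $\cos\theta=\rho$; a rational triangle having an angle equal to $\theta$ is called a $\theta$-triangle. A genuine pair for $\rho$ is a pair $(T,I)$ of non-degenerate rational triangles such that $T$ is a $\theta$-triangle, $I$ is isosceles, $T$ and $I$ have the same perimeter and the same area, and $T$ and $I$ are not congruent; then $I$ is called a genuine rational isosceles partner of $T$. *)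

theory Defs
  imports "HOL-Analysis.Analysis"
begin

text \<open>A triangle is given by its three vertices in the Euclidean plane; degenerate triples are
  excluded only where nondegeneracy is required explicitly.\<close>

type_synonym triangle = "(real^2) \<times> (real^2) \<times> (real^2)"

fun vertices :: "triangle \<Rightarrow> (real^2) set" where
  "vertices (A, B, C) = {A, B, C}"

definition nondegenerate :: "triangle \<Rightarrow> bool" where
  "nondegenerate T \<longleftrightarrow> \<not> collinear (vertices T)"

fun rational_sides :: "triangle \<Rightarrow> bool" where
  "rational_sides (A, B, C) \<longleftrightarrow> dist A B \<in> \<rat> \<and> dist B C \<in> \<rat> \<and> dist C A \<in> \<rat>"

definition rational_triangle :: "triangle \<Rightarrow> bool" where
  "rational_triangle T \<longleftrightarrow> nondegenerate T \<and> rational_sides T"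

fun perimeter :: "triangle \<Rightarrow> real" where
  "perimeter (A, B, C) = dist A B + dist B C + dist C A"

definition area :: "triangle \<Rightarrow> real" where
  "area T = measure lborel (convex hull (vertices T))"

text \<open>The unoriented angle \<open>\<angle>PQR\<close> at the middle point, in \<open>[0, \<pi>]\<close>;
  meaningful only if \<open>P \<noteq> Q\<close> and \<open>R \<noteq> Q\<close>.\<close>

definition angle :: "real^2 \<Rightarrow> real^2 \<Rightarrow> real^2 \<Rightarrow> real" where
  "angle P Q R = arccos (((P - Q) \<bullet> (R - Q)) / (norm (P - Q) * norm (R - Q)))"

fun has_angle :: "triangle \<Rightarrow> real \<Rightarrow> bool" where
  "has_angle (A, B, C) \<theta> \<longleftrightarrow> angle B A C = \<theta> \<or> angle C B A = \<theta> \<or> angle A C B = \<theta>"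

text \<open>Isosceles means at least two equal sides, so equilateral triangles are included.\<close>

fun isosceles :: "triangle \<Rightarrow> bool" where
  "isosceles (A, B, C) \<longleftrightarrow> dist A B = dist B C \<or> dist B C = dist C A \<or> dist C A = dist A B"

definition scalene :: "triangle \<Rightarrow> bool" where
  "scalene T \<longleftrightarrow> \<not> isosceles T"

text \<open>Congruence does not depend on the order of the vertices, and reflections are allowed.\<close>

definition congruent_triangles :: "triangle \<Rightarrow> triangle \<Rightarrow> bool" where
  "congruent_triangles T U \<longleftrightarrow>
     (\<exists>f :: real^2 \<Rightarrow> real^2. (\<forall>x y. dist (f x) (f y) = dist x y) \<and> f ` vertices T = vertices U)"

definition theta_triangle :: "real \<Rightarrow> triangle \<Rightarrow> bool" where
  "theta_triangle \<theta> T \<longleftrightarrow> rational_triangle T \<and> has_angle T \<theta>"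

text \<open>For \<open>\<rho>\<close> in \<open>(-1, 1)\<close>, \<open>arccos \<rho>\<close> is the unique \<open>\<theta>\<close> in \<open>(0, \<pi>)\<close> with \<open>cos \<theta> = \<rho>\<close>.\<close>

definition genuine_pair :: "real \<Rightarrow> triangle \<Rightarrow> triangle \<Rightarrow> bool" where
  "genuine_pair \<rho> T I \<longleftrightarrow>
     theta_triangle (arccos \<rho>) T \<and> rational_triangle I \<and> isosceles I \<and>
     perimeter T = perimeter I \<and> area T = area I \<and> \<not> congruent_triangles T I"

end

theory Submission
  imports Defs
begin

text \<open>
  Write the side lengths of a triangle as \<open>x + y\<close>, \<open>y + z\<close>, \<open>z + x\<close>, where the positive numbers
  \<open>x, y, z\<close> are the lengths of the tangents from the vertices to the incircle. The semiperimeter is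
  \<open>s = x + y + z\<close> and by Heron the squared area is \<open>s x y z\<close>. An isosceles triangle with tangent
  lengths \<open>u, u, w\<close> therefore has the same perimeter and area if and only if \<open>w = s - 2 u\<close> and
  \<open>2 u\<^sup>3 - s u\<^sup>2 + x y z = 0\<close>. If this cubic has two rational roots then their ratio \<open>q : r\<close>
  determines it up to scaling, because the linear coefficient vanishes. In suitable
  units the roots are \<open>q (q + r)\<close>, \<open>r (q + r)\<close> and \<open>- q r\<close>, so that two rational isosceles
  partners amount to rational solutions of
  \<open>x + y + z = 2 (q\<^sup>2 + q r + r\<^sup>2)\<close> and \<open>x y z = 2 q\<^sup>2 r\<^sup>2 (q + r)\<^sup>2\<close>.

  For fixed \<open>q : r\<close> this is an elliptic curve in \<open>(x, y, z)\<close>, but letting \<open>q : r\<close> vary as well gives a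
  surface that contains a useful rational curve. Put \<open>x = (q + r)\<^sup>2 / 2\<close>. Then \<open>y\<close> and \<open>z\<close> have
  sum \<open>A = (q + r)\<^sup>2 / 2 + q\<^sup>2 + r\<^sup>2\<close> and product \<open>4 q\<^sup>2 r\<^sup>2\<close>, and the discriminant of their quadratic
  is
  \<open>A\<^sup>2 - 16 q\<^sup>2 r\<^sup>2 = (q - r)\<^sup>2 (9/4 (q\<^sup>2 + r\<^sup>2) + 15/2 q r)\<close>.
  Hence \<open>y\<close> and \<open>z\<close> are rational once the last factor is a square \<open>W\<^sup>2\<close>. This is a conic
  with the rational point \<open>(q, r, W) = (0, 1, 3/2)\<close>. The lines
  \<open>W = 3/2 r + a/2 q\<close> through that point parametrize it by \<open>a\<close>, with \<open>q = 6 (5 - a)\<close> and \<open>r = a\<^sup>2 - 9\<close>,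
  and \<open>q, r > 0\<close> for \<open>3 < a < 5\<close>.

  Along this curve the cosine of the angle at the vertex with tangent length \<open>y\<close> is a continuous
  function of \<open>a \<in> [3, 5]\<close>. It equals \<open>1\<close> at \<open>a = 3\<close> and \<open>-1\<close> at \<open>a = 5\<close>, where the triangle
  degenerates, so it takes every value in between, and its values at rational \<open>a\<close> are dense in
  \<open>(-1, 1)\<close>. For each rational \<open>a\<close> strictly between \<open>3\<close> and \<open>5\<close> the triangle is scalene and the two
  partners differ: all coincidences reduce to \<open>q = r\<close>, that is to \<open>(a + 3)\<^sup>2 = 48\<close>, and \<open>48\<close> is
  not the square of a rational number.
\<close>

section \<open>Triangles described by their tangent lengths\<close>

fun tangent_lengths :: "triangle \<Rightarrow> real \<Rightarrow> real \<Rightarrow> real \<Rightarrow> bool" where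
  "tangent_lengths (A, B, C) x y z \<longleftrightarrow>
     x > 0 \<and> y > 0 \<and> z > 0 \<and> dist A B = x + y \<and> dist B C = y + z \<and> dist C A = z + x"

text \<open>The vertices are \<open>(0, 0)\<close>, \<open>(x + y, 0)\<close> and \<open>(m, h)\<close>, where \<open>m\<close> comes from the law of
  cosines and the height \<open>h\<close> is twice Heron's area divided by the base.\<close>

lemma tangent_lengths_exists:
  fixes x y z :: real
  assumes "x > 0" "y > 0" "z > 0"
  obtains T where "tangent_lengths T x y z"
proof -
  define m where "m = (x * (x + y + z) - y * z) / (x + y)"
  define h where "h = 2 * sqrt ((x + y + z) * x * y * z) / (x + y)"
  define A B C :: "real^2" where "A = vector [0, 0]" and "B = vector [x + y, 0]" and "C = vector [m, h]"
  have h2: "(x + y)\<^sup>2 * h\<^sup>2 = 4 * ((x + y + z) * x * y * z)"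
    using assms by (simp add: h_def power_divide power_mult_distrib)
  have m: "(x + y) * m = x * (x + y + z) - y * z"
    using assms by (simp add: m_def)
  have "(x + y)\<^sup>2 * (m\<^sup>2 + h\<^sup>2) = ((x + y) * m)\<^sup>2 + (x + y)\<^sup>2 * h\<^sup>2"
    by (simp add: algebra_simps power2_eq_square)
  also have "\<dots> = (x + y)\<^sup>2 * (z + x)\<^sup>2"
    unfolding m h2 by (simp add: algebra_simps power2_eq_square)
  finally have CA: "m\<^sup>2 + h\<^sup>2 = (z + x)\<^sup>2"
    using assms by simp
  have "(x + y - m)\<^sup>2 + h\<^sup>2 = (x + y)\<^sup>2 - 2 * ((x + y) * m) + (m\<^sup>2 + h\<^sup>2)"
    by (simp add: algebra_simps power2_eq_square)
  also have "\<dots> = (y + z)\<^sup>2"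
    unfolding m CA by (simp add: algebra_simps power2_eq_square)
  finally have BC: "(x + y - m)\<^sup>2 + h\<^sup>2 = (y + z)\<^sup>2" .
  have "dist A B = x + y" "dist B C = y + z" "dist C A = z + x"
    using assms CA BC
    by (simp_all add: A_def B_def C_def dist_vec_def L2_set_def UNIV_2 dist_real_def)
  then have "tangent_lengths (A, B, C) x y z"
    using assms by simp
  then show thesis by (rule that)
qed

lemma nondegenerate_tangent_lengths:
  assumes "tangent_lengths T x y z"
  shows "nondegenerate T"
proof -
  obtain A B C where T: "T = (A, B, C)" by (cases T)
  have "\<not> collinear {A, B, C}"
    using assms unfolding T
    by (auto simp: collinear_between_cases between dist_commute)
  then show ?thesis by (simp add: T nondegenerate_def)
qed

lemma perimeter_tangent_lengths:
  assumes "tangent_lengths T x y z"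
  shows "perimeter T = 2 * (x + y + z)"
  using assms by (cases T) simp

lemma area_tangent_lengths:
  assumes "tangent_lengths T x y z"
  shows "area T = sqrt ((x + y + z) * (x * y * z))"
proof -
  obtain A B C where T: "T = (A, B, C)" by (cases T)
  have d: "dist B C = y + z" "dist A C = z + x" "dist A B = x + y"
    using assms by (auto simp: T dist_commute)
  have "area T = measure lborel (convex hull {A, B, C})"
    by (simp add: area_def T)
  also have "\<dots> = sqrt ((x + y + z) * (x * y * z))"
    unfolding heron d by (rule arg_cong[of _ _ sqrt]) (simp add: field_simps)
  finally show ?thesis .
qed

text \<open>The law of cosines at the middle vertex, whose adjacent sides are \<open>x + y\<close> and \<open>y + z\<close>.\<close>

lemma has_angle_tangent_lengths:
  assumes "tangent_lengths T x y z"
  shows "has_angle T (arccos (((x + y + z) * y - x * z) / ((x + y) * (y + z))))"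
proof -
  obtain A B C where T: "T = (A, B, C)" by (cases T)
  have n: "norm (C - B) = y + z" "norm (A - B) = x + y" "norm (C - A) = z + x"
    using assms by (auto simp: T dist_norm norm_minus_commute)
  have "2 * ((C - B) \<bullet> (A - B)) = (norm (C - B))\<^sup>2 + (norm (A - B))\<^sup>2 - (norm (C - A))\<^sup>2"
    by (simp add: power2_norm_eq_inner algebra_simps inner_commute)
  also have "\<dots> = 2 * ((x + y + z) * y - x * z)"
    unfolding n by (simp add: algebra_simps power2_eq_square)
  finally have "(C - B) \<bullet> (A - B) = (x + y + z) * y - x * z" by simp
  then have "angle C B A = arccos (((x + y + z) * y - x * z) / ((x + y) * (y + z)))"
    unfolding angle_def n by (simp add: mult.commute)
  then show ?thesis by (simp add: T)
qed

lemma rational_triangle_tangent_lengths: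
  assumes "tangent_lengths T x y z" "x \<in> \<rat>" "y \<in> \<rat>" "z \<in> \<rat>"
  shows "rational_triangle T"
  using assms nondegenerate_tangent_lengths[OF assms(1)]
  by (cases T) (auto simp: rational_triangle_def)

lemma isosceles_tangent_lengths:
  assumes "tangent_lengths T x y z"
  shows "isosceles T \<longleftrightarrow> x = y \<or> y = z \<or> z = x"
  using assms by (cases T) auto

section \<open>Congruence\<close>

fun side_lengths :: "triangle \<Rightarrow> real set" where
  "side_lengths (A, B, C) = {dist A B, dist B C, dist C A}"

text \<open>Describing the side lengths through the vertex set alone makes them visibly invariant under
  isometries, which need not respect the order of the vertices.\<close>

lemma side_lengths_eq_distances:
  assumes "nondegenerate T"
  shows "side_lengths T = {dist P Q |P Q. P \<in> vertices T \<and> Q \<in> vertices T \<and> P \<noteq> Q}"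
proof -
  obtain A B C where T: "T = (A, B, C)" by (cases T)
  have "A \<noteq> B" "B \<noteq> C" "C \<noteq> A"
    using assms by (auto simp: T nondegenerate_def insert_commute)
  then show ?thesis
    by (auto simp: T) (metis dist_commute)+
qed

lemma side_lengths_congruent:
  assumes "congruent_triangles T U" "nondegenerate T" "nondegenerate U"
  shows "side_lengths T = side_lengths U"
proof -
  obtain f where f: "\<And>x y. dist (f x) (f y) = dist x y" and im: "f ` vertices T = vertices U"
    using assms(1) by (auto simp: congruent_triangles_def)
  have inj: "f x = f y \<longleftrightarrow> x = y" for x y
    by (metis f dist_eq_0_iff)
  have "{dist P Q |P Q. P \<in> f ` vertices T \<and> Q \<in> f ` vertices T \<and> P \<noteq> Q} =
      {dist (f P) (f Q) |P Q. P \<in> vertices T \<and> Q \<in> vertices T \<and> f P \<noteq> f Q}"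
    by blast
  then show ?thesis
    unfolding side_lengths_eq_distances[OF assms(2)] side_lengths_eq_distances[OF assms(3)]
      im[symmetric] f inj by (rule sym)
qed

lemma isosceles_iff_card_side_lengths: "isosceles T \<longleftrightarrow> card (side_lengths T) \<le> 2"
  by (cases T) (auto simp: card_insert_if)

lemma side_lengths_tangent_lengths:
  assumes "tangent_lengths T x y z"
  shows "side_lengths T = {x + y, y + z, z + x}"
  using assms by (cases T) simp

text \<open>Sharing the perimeter and the area means sharing the sum and the product of the tangent
  lengths. Non-congruence comes for free, since a scalene triangle has three different side
  lengths and an isosceles one has at most two.\<close>

lemma genuine_pair_tangent_lengths:
  assumes T: "tangent_lengths T x y z" and I: "tangent_lengths I u u w"
    and rat: "x \<in> \<rat>" "y \<in> \<rat>" "z \<in> \<rat>" "u \<in> \<rat>" "w \<in> \<rat>"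
    and sc: "scalene T"
    and sum: "x + y + z = 2 * u + w" and prod: "x * y * z = u\<^sup>2 * w"
  shows "genuine_pair (((x + y + z) * y - x * z) / ((x + y) * (y + z))) T I"
proof -
  have iso: "isosceles I"
    using I isosceles_tangent_lengths by blast
  have "\<not> congruent_triangles T I"
    using side_lengths_congruent[of T I] nondegenerate_tangent_lengths[OF T]
      nondegenerate_tangent_lengths[OF I] iso sc
    by (auto simp: scalene_def isosceles_iff_card_side_lengths)
  moreover have "area T = area I"
    unfolding area_tangent_lengths[OF T] area_tangent_lengths[OF I] prod sum
    by (simp add: power2_eq_square)
  ultimately show ?thesis
    using iso rational_triangle_tangent_lengths[OF T] rational_triangle_tangent_lengths[OF I]
      has_angle_tangent_lengths[OF T] rat sum
    unfolding genuine_pair_def theta_triangle_def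
      perimeter_tangent_lengths[OF T] perimeter_tangent_lengths[OF I]
    by simp
qed

lemma sqrt_3_irrational:
  fixes t :: real
  assumes "t \<in> \<rat>"
  shows "t\<^sup>2 \<noteq> 3"
proof
  assume t: "t\<^sup>2 = 3"
  obtain m n :: nat where mn: "n \<noteq> 0" "\<bar>t\<bar> = real m / real n" "coprime m n"
    using assms Rats_abs_nat_div_natE by blast
  have "real m = \<bar>t\<bar> * real n"
    using mn by simp
  then have "(real m)\<^sup>2 = 3 * (real n)\<^sup>2"
    by (simp add: power_mult_distrib t)
  then have eq: "m\<^sup>2 = 3 * n\<^sup>2"
    by (metis of_nat_eq_iff of_nat_mult of_nat_numeral of_nat_power)
  have p3: "prime (3 :: nat)" by simp
  have "3 dvd m"
    using eq p3 prime_dvd_power by (metis dvd_triv_left)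
  then obtain k where "m = 3 * k" ..
  with eq have "n\<^sup>2 = 3 * k\<^sup>2"
    by (simp add: power2_eq_square)
  then have "3 dvd n"
    using p3 prime_dvd_power by (metis dvd_triv_left)
  with \<open>3 dvd m\<close> mn(3) show False
    by (metis coprime_def nat_dvd_1_iff_1 numeral_eq_one_iff semiring_norm(86))
qed

section \<open>The equations for two isosceles partners\<close>

definition double_partner_cosine :: "real \<Rightarrow> bool" where
  "double_partner_cosine \<rho> \<longleftrightarrow> \<rho> \<in> \<rat> \<and> -1 < \<rho> \<and> \<rho> < 1 \<and>
    (\<exists>T I\<^sub>1 I\<^sub>2. scalene T \<and> genuine_pair \<rho> T I\<^sub>1 \<and> genuine_pair \<rho> T I\<^sub>2 \<and>
       \<not> congruent_triangles I\<^sub>1 I\<^sub>2)"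

text \<open>The partners have tangent lengths \<open>q (q + r), q (q + r), 2 r\<^sup>2\<close> and
  \<open>r (q + r), r (q + r), 2 q\<^sup>2\<close>, given by the two positive roots of the cubic above.\<close>

lemma double_partner_cosineI:
  fixes q r x y z :: real
  assumes rat: "q \<in> \<rat>" "r \<in> \<rat>" "x \<in> \<rat>" "y \<in> \<rat>" "z \<in> \<rat>"
    and pos: "q > 0" "r > 0" "x > 0" "y > 0" "z > 0"
    and "q \<noteq> r" and distinct: "x \<noteq> y" "y \<noteq> z" "z \<noteq> x"
    and sum: "x + y + z = 2 * (q\<^sup>2 + q * r + r\<^sup>2)"
    and prod: "x * y * z = 2 * q\<^sup>2 * r\<^sup>2 * (q + r)\<^sup>2"
  shows "double_partner_cosine (((x + y + z) * y - x * z) / ((x + y) * (y + z)))"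
    (is "double_partner_cosine ?\<rho>")
proof -
  define u\<^sub>1 u\<^sub>2 w\<^sub>1 w\<^sub>2 where
    defs: "u\<^sub>1 = q * (q + r)" "u\<^sub>2 = r * (q + r)" "w\<^sub>1 = 2 * r\<^sup>2" "w\<^sub>2 = 2 * q\<^sup>2"
  have uw: "u\<^sub>1 > 0" "u\<^sub>2 > 0" "w\<^sub>1 > 0" "w\<^sub>2 > 0" "u\<^sub>1 \<in> \<rat>" "u\<^sub>2 \<in> \<rat>" "w\<^sub>1 \<in> \<rat>" "w\<^sub>2 \<in> \<rat>"
    using pos rat by (auto simp: defs)
  obtain T where T: "tangent_lengths T x y z"
    using pos tangent_lengths_exists by blast
  obtain I\<^sub>1 where I1: "tangent_lengths I\<^sub>1 u\<^sub>1 u\<^sub>1 w\<^sub>1"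
    using uw tangent_lengths_exists by blast
  obtain I\<^sub>2 where I2: "tangent_lengths I\<^sub>2 u\<^sub>2 u\<^sub>2 w\<^sub>2"
    using uw tangent_lengths_exists by blast
  have sc: "scalene T"
    using distinct isosceles_tangent_lengths[OF T] by (auto simp: scalene_def)
  have g1: "genuine_pair ?\<rho> T I\<^sub>1"
    using T I1 rat(3-5) uw(5) uw(7) sc
    by (rule genuine_pair_tangent_lengths)
      (simp_all only: sum prod defs, simp_all add: power2_eq_square algebra_simps)
  have g2: "genuine_pair ?\<rho> T I\<^sub>2"
    using T I2 rat(3-5) uw(6) uw(8) sc
    by (rule genuine_pair_tangent_lengths)
      (simp_all only: sum prod defs, simp_all add: power2_eq_square algebra_simps)
  have "\<not> congruent_triangles I\<^sub>1 I\<^sub>2"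
  proof
    assume "congruent_triangles I\<^sub>1 I\<^sub>2"
    then have "side_lengths I\<^sub>1 = side_lengths I\<^sub>2"
      using side_lengths_congruent nondegenerate_tangent_lengths I1 I2 by blast
    then have eq: "{u\<^sub>1 + u\<^sub>1, u\<^sub>1 + w\<^sub>1} = {u\<^sub>2 + u\<^sub>2, u\<^sub>2 + w\<^sub>2}"
      unfolding side_lengths_tangent_lengths[OF I1] side_lengths_tangent_lengths[OF I2]
      by (simp add: add.commute)
    then consider "u\<^sub>1 = u\<^sub>2" | "2 * u\<^sub>1 = u\<^sub>2 + w\<^sub>2"
      by (auto simp: doubleton_eq_iff)
    then show False
    proof cases
      case 1
      then show False using pos \<open>q \<noteq> r\<close> by (simp add: defs)
    next
      case 2
      then have "r * q = r * r"
        by (simp add: defs power2_eq_square algebra_simps)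
      then show False using pos \<open>q \<noteq> r\<close> by simp
    qed
  qed
  moreover have "?\<rho> \<in> \<rat>"
    using rat by (intro Rats_divide Rats_diff Rats_mult Rats_add)
  moreover have "(x + y) * (y + z) > 0" "x * z > 0" "(x + y + z) * y > 0"
    using pos by simp_all
  then have "-1 < ?\<rho>" "?\<rho> < 1"
    by (simp_all add: field_simps)
  ultimately show ?thesis
    using sc g1 g2 unfolding double_partner_cosine_def by blast
qed

section \<open>A rational curve of solutions\<close>

text \<open>The functions below are the parametrization of the conic and the resulting tangent lengths.
  On the conic \<open>W = 3/2 r + a/2 q\<close>, which factors as stated in the definition of \<open>fam_W\<close>.\<close>

definition fam_q :: "real \<Rightarrow> real" where "fam_q a = 6 * (5 - a)"
definition fam_r :: "real \<Rightarrow> real" where "fam_r a = a\<^sup>2 - 9"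
definition fam_A :: "real \<Rightarrow> real" where
  "fam_A a = (fam_q a + fam_r a)\<^sup>2 / 2 + (fam_q a)\<^sup>2 + (fam_r a)\<^sup>2"
definition fam_W :: "real \<Rightarrow> real" where
  "fam_W a = (3 / 2) * (a - 1) * (9 - a)"
definition fam_x :: "real \<Rightarrow> real" where
  "fam_x a = (fam_q a + fam_r a)\<^sup>2 / 2"
definition fam_y :: "real \<Rightarrow> real" where
  "fam_y a = (fam_A a + (fam_q a - fam_r a) * fam_W a) / 2"
definition fam_z :: "real \<Rightarrow> real" where
  "fam_z a = (fam_A a - (fam_q a - fam_r a) * fam_W a) / 2"

lemmas fam_defs = fam_q_def fam_r_def fam_A_def fam_W_def fam_x_def fam_y_def fam_z_def

text \<open>This is the identity that makes the curve lie on the surface: \<open>A\<^sup>2 - (q - r)\<^sup>2 W\<^sup>2\<close> collapses to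
  \<open>16 q\<^sup>2 r\<^sup>2\<close> after \<open>W\<^sup>2\<close> is replaced using the equation of the conic.\<close>

lemma fam_yz: "fam_y a * fam_z a = 4 * (fam_q a)\<^sup>2 * (fam_r a)\<^sup>2"
proof -
  have "(fam_W a)\<^sup>2 = 9 / 4 * ((fam_q a)\<^sup>2 + (fam_r a)\<^sup>2) + 15 / 2 * fam_q a * fam_r a"
    by (simp add: fam_W_def fam_q_def fam_r_def power2_eq_square field_simps)
  moreover have "4 * (fam_y a * fam_z a) = (fam_A a)\<^sup>2 - (fam_q a - fam_r a)\<^sup>2 * (fam_W a)\<^sup>2"
    by (simp add: fam_y_def fam_z_def power2_eq_square field_simps)
  ultimately have "4 * (fam_y a * fam_z a) = (fam_A a)\<^sup>2 - (fam_q a - fam_r a)\<^sup>2 *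
      (9 / 4 * ((fam_q a)\<^sup>2 + (fam_r a)\<^sup>2) + 15 / 2 * fam_q a * fam_r a)"
    by simp
  also have "\<dots> = 16 * (fam_q a)\<^sup>2 * (fam_r a)\<^sup>2"
    by (simp add: fam_A_def power2_eq_square field_simps)
  finally show ?thesis by simp
qed

lemma fam_sum: "fam_y a + fam_z a = fam_A a"
  by (simp add: fam_y_def fam_z_def field_simps)

text \<open>The cosine of the angle at the vertex with tangent length \<open>fam_y a\<close>.\<close>

definition fam_cos :: "real \<Rightarrow> real" where
  "fam_cos a = ((fam_x a + fam_y a + fam_z a) * fam_y a - fam_x a * fam_z a) /
     ((fam_x a + fam_y a) * (fam_y a + fam_z a))"

lemma pos_of_sum_prod_pos:
  fixes y z :: real
  assumes "y + z > 0" "y * z > 0"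
  shows "y > 0" "z > 0"
  using assms by (auto simp: zero_less_mult_iff)

text \<open>Scaleneness has two reasons. The difference \<open>y - z = (q - r) W\<close> vanishes only for \<open>q = r\<close>.
  If \<open>x\<close> were a root of the quadratic with roots \<open>y\<close> and \<open>z\<close>, then
  \<open>(q + r)\<^sup>2 (q\<^sup>2 + r\<^sup>2) = 8 q\<^sup>2 r\<^sup>2\<close>; as \<open>(q + r)\<^sup>2 \<ge> 4 q r\<close> and \<open>q\<^sup>2 + r\<^sup>2 \<ge> 2 q r\<close>, this again
  forces \<open>q = r\<close>.\<close>

lemma double_partner_cosine_fam_cos:
  assumes a: "a \<in> \<rat>" "3 < a" "a < 5"
  shows "double_partner_cosine (fam_cos a)"
proof -
  define q r x y z where vars: "q = fam_q a" "r = fam_r a" "x = fam_x a" "y = fam_y a" "z = fam_z a"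
  have W: "fam_W a > 0"
    using a by (simp add: fam_W_def)
  have q: "q > 0"
    using a by (simp add: vars fam_q_def)
  have "3\<^sup>2 < a\<^sup>2"
    using a by (intro power_strict_mono) auto
  then have r: "r > 0"
    by (simp add: vars fam_r_def)
  have x: "x = (q + r)\<^sup>2 / 2"
    by (simp add: vars fam_x_def)
  have yz: "y * z = 4 * q\<^sup>2 * r\<^sup>2" and ypz: "y + z = (q + r)\<^sup>2 / 2 + q\<^sup>2 + r\<^sup>2"
    by (simp_all add: vars fam_yz fam_sum fam_A_def)
  have pos: "x > 0" "y > 0" "z > 0"
  proof -
    show "x > 0" using q r by (simp add: x)
    have "y + z > 0" unfolding ypz using q r by (intro add_pos_pos) auto
    moreover have "y * z > 0" unfolding yz using q r by simp
    ultimately show "y > 0" "z > 0" by (auto dest: pos_of_sum_prod_pos)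
  qed
  have "q \<noteq> r"
  proof
    assume "q = r"
    then have "(a + 3)\<^sup>2 = 48"
      by (simp add: vars fam_q_def fam_r_def power2_eq_square algebra_simps)
    then have sq: "((a + 3) / 4)\<^sup>2 = 3"
      by (simp add: power_divide)
    have "(a + 3) / 4 \<in> \<rat>"
      using a by simp
    then show False
      using sq sqrt_3_irrational by blast
  qed
  have ne: "x \<noteq> t" if "t * (y + z - t) = y * z" for t
  proof
    assume "x = t"
    with that have "x * (y + z - x) = y * z" by simp
    then have "(q + r)\<^sup>2 * (q\<^sup>2 + r\<^sup>2) = 8 * q\<^sup>2 * r\<^sup>2"
      unfolding ypz yz x by simp
    then have "(q - r)\<^sup>2 * (q\<^sup>2 + r\<^sup>2 + 4 * q * r) = 0"
      by algebra
    moreover have "q\<^sup>2 + r\<^sup>2 + 4 * q * r > 0"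
      using q r by (intro add_pos_pos) auto
    ultimately show False
      using \<open>q \<noteq> r\<close> by simp
  qed
  have "double_partner_cosine (((x + y + z) * y - x * z) / ((x + y) * (y + z)))"
  proof (rule double_partner_cosineI)
    show "q \<in> \<rat>" "r \<in> \<rat>" "x \<in> \<rat>" "y \<in> \<rat>" "z \<in> \<rat>"
      using a by (simp_all add: vars fam_defs)
    show "x \<noteq> y" "z \<noteq> x"
      using ne[of y] ne[of z] by auto
    have "y - z = (q - r) * fam_W a"
      by (simp add: vars fam_y_def fam_z_def field_simps)
    then show "y \<noteq> z"
      using \<open>q \<noteq> r\<close> W by auto
    show "x + y + z = 2 * (q\<^sup>2 + q * r + r\<^sup>2)"
      using ypz by (simp add: x power2_eq_square field_simps)
    have "x * y * z = x * (y * z)" by simp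
    also have "\<dots> = 2 * q\<^sup>2 * r\<^sup>2 * (q + r)\<^sup>2"
      by (simp add: yz x)
    finally show "x * y * z = 2 * q\<^sup>2 * r\<^sup>2 * (q + r)\<^sup>2" .
  qed (use q r pos \<open>q \<noteq> r\<close> in auto)
  then show ?thesis
    by (simp add: vars fam_cos_def)
qed

section \<open>Density\<close>

text \<open>The closed interval matters here, because the extreme values \<open>1\<close> and \<open>-1\<close> are attained at its
  end points. There \<open>y\<close> or \<open>z\<close> vanishes, but the denominator \<open>(x + y) (y + z)\<close> stays positive.\<close>

lemma continuous_on_fam_cos: "continuous_on {3..5} fam_cos"
proof -
  have cont: "continuous_on {3..5} fam_x" "continuous_on {3..5} fam_y" "continuous_on {3..5} fam_z"
    unfolding fam_x_def fam_y_def fam_z_def fam_A_def fam_W_def fam_q_def fam_r_def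
    by (auto intro!: continuous_intros)
  have "(fam_x a + fam_y a) * (fam_y a + fam_z a) \<noteq> 0" if "a \<in> {3..5}" for a
  proof -
    have q: "fam_q a \<ge> 0" and r: "fam_r a \<ge> 0"
      using that power_mono[of 3 a 2] by (auto simp: fam_q_def fam_r_def)
    have "fam_q a + fam_r a = (a - 3)\<^sup>2 + 12"
      by (simp add: fam_q_def fam_r_def power2_eq_square algebra_simps)
    then have p: "fam_q a + fam_r a > 0"
      by (simp add: add_nonneg_pos)
    then have x: "fam_x a > 0"
      by (simp add: fam_x_def)
    have s: "fam_y a + fam_z a > 0"
      unfolding fam_sum fam_A_def using p by (intro add_pos_nonneg) auto
    have "fam_y a * fam_z a \<ge> 0"
      unfolding fam_yz by simp
    with s have "fam_y a \<ge> 0"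
      by (auto simp: zero_le_mult_iff)
    with x s show ?thesis by simp
  qed
  then show ?thesis
    unfolding fam_cos_def by (intro continuous_intros cont ballI)
qed

theorem theorem7p5:
  shows "{-1<..<1} \<subseteq> closure {\<rho> :: real. \<rho> \<in> \<rat> \<and> -1 < \<rho> \<and> \<rho> < 1 \<and>
    (\<exists>T I\<^sub>1 I\<^sub>2. scalene T \<and> genuine_pair \<rho> T I\<^sub>1 \<and> genuine_pair \<rho> T I\<^sub>2 \<and>
       \<not> congruent_triangles I\<^sub>1 I\<^sub>2)}"
proof -
  have "{-1<..<1} \<subseteq> closure (Collect double_partner_cosine)"
  proof
    fix c :: real assume "c \<in> {-1<..<1}"
    have ends: "fam_cos 3 = 1" "fam_cos 5 = -1"
      by (simp_all add: fam_cos_def fam_defs)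
    obtain a where a: "3 \<le> a" "a \<le> 5" "fam_cos a = c"
      using IVT2'[of fam_cos 5 c 3] continuous_on_fam_cos ends \<open>c \<in> _\<close> by auto
    have cl: "closure (\<rat> \<inter> {3<..<5}) = {3..5 :: real}"
      using closure_open_Int_superset[of "{3<..<5}" "\<rat> :: real set"]
      by (simp add: Rats_closure_real Int_commute)
    have "fam_cos ` {3..5} \<subseteq> closure (Collect double_partner_cosine)"
      unfolding cl[symmetric]
      by (rule image_closure_subset)
        (use continuous_on_fam_cos double_partner_cosine_fam_cos closure_subset in \<open>force simp: cl\<close>)+
    then show "c \<in> closure (Collect double_partner_cosine)"
      using a by auto
  qed
  then show ?thesis
    unfolding double_partner_cosine_def .
qed

end
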